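(* Assume, in addition to the standing assumptions listed in the context, that: (i) $P$ and $U$ are convex subsets of real vector spaces; (ii) $\lambda S(p_1,u_1) + (1-\lambda) S(p_2,u_2) \leq S(\lambda p_1 + (1-\lambda)p_2, \lambda u_1 + (1-\lambda)u_2)$ for all $p_1,p_2 \in P$, $u_1,u_2 \in U$, $\lambda \in [0,1]$; (iii) $\lambda \Phi(v_1) + (1-\lambda)\Phi(v_2) \leq \Phi(\lambda v_1 + (1-\lambda)v_2)$ for all $v_1,v_2 \in L^2_+(X)$ and $\lambda \in [0,1]$. Let $u \in U$ and $h \in \mathbb{R}^+(U-u)$ be given such that $u + \tau h \in U$ for all $\tau \in (0,\tau_0)$, where $\tau_0>0$. Define \[ \delta_\tau := \frac{M(u+\tau h) - M(u)}{\tau}, \qquad \tau \in (0,\tau_0). \] Then there exists a unique $\delta \in L^0(X,(-\infty,\infty])$ such that, for every sequence $\{\tau_n\} \subset (0,\tau_0)$ satisfying $\tau_n \to 0$, it holds $\delta_{\tau_n} \to \delta$ pointwise $\mu$-a.e. in $X$.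
   Context: Standing assumptions and notation. $(X,\Sigma,\mu)$ is a complete measure space. $L^q(X)$ are the usual Lebesgue spaces, ordered by $v_1 \leq v_2 :\iff v_1 \leq v_2$ $\mu$-a.e. in $X$, and $L^q_+(X) := \{v \in L^q(X) \mid v \geq 0\}$. $L^0(X,(-\infty,\infty])$ is the set of equivalence classes (modulo $\mu$-a.e. equality) of measurable functions on $X$ with values in $(-\infty,\infty]$. $\bar P$ is a set equipped with a partial order $\leq$, having at least two elements and a largest element $\bar p$; $P := \bar P \setminus \{\bar p\}$. $U$ is a nonempty set. $S\colon \bar P \times U \to L^2_+(X)$ satisfies $S(p_1,u) \leq S(p_2,u)$ for all $u \in U$ and $p_1,p_2 \in \bar P$ with $p_1 \leq p_2$. $\Phi\colon L^2(X) \to P$ satisfies $\Phi(v_1) \leq \Phi(v_2)$ for all $v_1,v_2 \in L^2(X)$ with $v_1 \leq v_2$. $\mathbb{R}^+(U-u) := \{\lambda (w-u) \mid \lambda > 0,\ w \in U\}$. For $u \in U$, problem (F) with parameter $u$ is: find $y \in L^2(X)$ with $y = S(\Phi(y),u)$. Under the standing assumptions, for every $u \in U$ the solution set of (F) is nonempty and possesses a unique largest element $M(u)$ (the maximal solution). *)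

theory Defs
  imports "HOL-Analysis.Analysis"
begin

section \<open>Function spaces modulo almost everywhere equality\<close>

definition ae_eq_rel :: "'a measure \<Rightarrow> ('a \<Rightarrow> 'b) set \<Rightarrow> (('a \<Rightarrow> 'b) \<times> ('a \<Rightarrow> 'b)) set" where
  "ae_eq_rel \<mu> A = {(f, g). f \<in> A \<and> g \<in> A \<and> (AE x in \<mu>. f x = g x)}"

definition rep :: "('a \<Rightarrow> 'b) set \<Rightarrow> 'a \<Rightarrow> 'b" where
  "rep v = (SOME f. f \<in> v)"

definition square_integrable :: "'a measure \<Rightarrow> ('a \<Rightarrow> real) set" where
  "square_integrable \<mu> = {f \<in> borel_measurable \<mu>. integrable \<mu> (\<lambda>x. (f x)\<^sup>2)}"

definition L2 :: "'a measure \<Rightarrow> ('a \<Rightarrow> real) set set" where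
  "L2 \<mu> = square_integrable \<mu> // ae_eq_rel \<mu> (square_integrable \<mu>)"

definition L2_class :: "'a measure \<Rightarrow> ('a \<Rightarrow> real) \<Rightarrow> ('a \<Rightarrow> real) set" where
  "L2_class \<mu> f = ae_eq_rel \<mu> (square_integrable \<mu>) `` {f}"

definition L2_le :: "'a measure \<Rightarrow> ('a \<Rightarrow> real) set \<Rightarrow> ('a \<Rightarrow> real) set \<Rightarrow> bool" where
  "L2_le \<mu> v w \<longleftrightarrow> (AE x in \<mu>. rep v x \<le> rep w x)"

definition L2_zero :: "'a measure \<Rightarrow> ('a \<Rightarrow> real) set" where
  "L2_zero \<mu> = L2_class \<mu> (\<lambda>x. 0)"

definition L2_add :: "'a measure \<Rightarrow> ('a \<Rightarrow> real) set \<Rightarrow> ('a \<Rightarrow> real) set \<Rightarrow> ('a \<Rightarrow> real) set" where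
  "L2_add \<mu> v w = L2_class \<mu> (\<lambda>x. rep v x + rep w x)"

definition L2_diff :: "'a measure \<Rightarrow> ('a \<Rightarrow> real) set \<Rightarrow> ('a \<Rightarrow> real) set \<Rightarrow> ('a \<Rightarrow> real) set" where
  "L2_diff \<mu> v w = L2_class \<mu> (\<lambda>x. rep v x - rep w x)"

definition L2_scale :: "'a measure \<Rightarrow> real \<Rightarrow> ('a \<Rightarrow> real) set \<Rightarrow> ('a \<Rightarrow> real) set" where
  "L2_scale \<mu> c v = L2_class \<mu> (\<lambda>x. c * rep v x)"

definition L2_nonneg :: "'a measure \<Rightarrow> ('a \<Rightarrow> real) set set" where
  "L2_nonneg \<mu> = {v \<in> L2 \<mu>. L2_le \<mu> (L2_zero \<mu>) v}"

text \<open>The space \<open>L\<^sup>0(X, (-\<infinity>, \<infinity>])\<close>. Only the values on \<open>space \<mu>\<close> are restricted, since the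
  values of a function outside \<open>space \<mu>\<close> carry no meaning.\<close>

definition meas_above_minf :: "'a measure \<Rightarrow> ('a \<Rightarrow> ereal) set" where
  "meas_above_minf \<mu> = {f \<in> borel_measurable \<mu>. \<forall>x\<in>space \<mu>. - \<infinity> < f x}"

definition L0_ext :: "'a measure \<Rightarrow> ('a \<Rightarrow> ereal) set set" where
  "L0_ext \<mu> = meas_above_minf \<mu> // ae_eq_rel \<mu> (meas_above_minf \<mu>)"

text \<open>Almost everywhere pointwise convergence of a sequence in \<open>L\<^sup>2\<close> to an element of
  \<open>L\<^sup>0(X, (-\<infinity>, \<infinity>])\<close>. As a sequence is countable, the choice of representatives is immaterial.\<close>

definition ae_tendsto :: "'a measure \<Rightarrow> (nat \<Rightarrow> ('a \<Rightarrow> real) set) \<Rightarrow> ('a \<Rightarrow> ereal) set \<Rightarrow> bool" where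
  "ae_tendsto \<mu> v d \<longleftrightarrow> (AE x in \<mu>. (\<lambda>n. ereal (rep (v n) x)) \<longlonglongrightarrow> rep d x)"

section \<open>Independence of the representatives\<close>

lemma equiv_ae_eq_rel: "equiv A (ae_eq_rel \<mu> A)"
proof (rule equivI)
  show "ae_eq_rel \<mu> A \<subseteq> A \<times> A" "refl_on A (ae_eq_rel \<mu> A)"
    by (auto simp: ae_eq_rel_def refl_on_def)
  show "sym (ae_eq_rel \<mu> A)"
  proof (rule symI)
    fix f g assume fg: "(f, g) \<in> ae_eq_rel \<mu> A"
    then have "AE x in \<mu>. f x = g x"
      by (simp add: ae_eq_rel_def)
    then have "AE x in \<mu>. g x = f x"
      by eventually_elim simp
    with fg show "(g, f) \<in> ae_eq_rel \<mu> A"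
      by (simp add: ae_eq_rel_def)
  qed
  show "trans (ae_eq_rel \<mu> A)"
  proof (rule transI)
    fix f g h assume fg: "(f, g) \<in> ae_eq_rel \<mu> A" and gh: "(g, h) \<in> ae_eq_rel \<mu> A"
    then have "AE x in \<mu>. f x = g x" "AE x in \<mu>. g x = h x"
      by (auto simp: ae_eq_rel_def)
    then have "AE x in \<mu>. f x = h x"
      by eventually_elim simp
    with fg gh show "(f, h) \<in> ae_eq_rel \<mu> A"
      by (simp add: ae_eq_rel_def)
  qed
qed

lemma rep_class:
  assumes "f \<in> A"
  shows "rep (ae_eq_rel \<mu> A `` {f}) \<in> A" "AE x in \<mu>. rep (ae_eq_rel \<mu> A `` {f}) x = f x"
proof -
  have "f \<in> ae_eq_rel \<mu> A `` {f}"
    using assms by (auto simp: ae_eq_rel_def)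
  then have "rep (ae_eq_rel \<mu> A `` {f}) \<in> ae_eq_rel \<mu> A `` {f}"
    unfolding rep_def by (rule someI[of "\<lambda>g. g \<in> _"])
  then have *: "(f, rep (ae_eq_rel \<mu> A `` {f})) \<in> ae_eq_rel \<mu> A"
    by (simp only: Image_singleton_iff)
  then show "rep (ae_eq_rel \<mu> A `` {f}) \<in> A"
    unfolding ae_eq_rel_def by blast
  from * have "AE x in \<mu>. f x = rep (ae_eq_rel \<mu> A `` {f}) x"
    unfolding ae_eq_rel_def by blast
  then show "AE x in \<mu>. rep (ae_eq_rel \<mu> A `` {f}) x = f x"
    by eventually_elim simp
qed

lemma rep_L2_class:
  assumes "f \<in> square_integrable \<mu>"
  shows "rep (L2_class \<mu> f) \<in> square_integrable \<mu>" "AE x in \<mu>. rep (L2_class \<mu> f) x = f x"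
  unfolding L2_class_def by (rule rep_class[OF assms])+

lemma L2_class_cong:
  assumes "AE x in \<mu>. f x = g x" "f \<in> square_integrable \<mu>" "g \<in> square_integrable \<mu>"
  shows "L2_class \<mu> f = L2_class \<mu> g"
  unfolding L2_class_def
  by (rule equiv_class_eq[OF equiv_ae_eq_rel]) (use assms in \<open>simp add: ae_eq_rel_def\<close>)

lemma square_integrable_scale:
  "f \<in> square_integrable \<mu> \<Longrightarrow> (\<lambda>x. c * f x) \<in> square_integrable \<mu>"
  by (auto simp: square_integrable_def power_mult_distrib)

lemma square_integrable_add:
  assumes "f \<in> square_integrable \<mu>" "g \<in> square_integrable \<mu>"
  shows "(\<lambda>x. f x + g x) \<in> square_integrable \<mu>"
proof -
  have [measurable]: "f \<in> borel_measurable \<mu>" "g \<in> borel_measurable \<mu>"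
    using assms by (simp_all add: square_integrable_def)
  have "integrable \<mu> (\<lambda>x. 2 * (f x)\<^sup>2 + 2 * (g x)\<^sup>2)"
    using assms by (simp add: square_integrable_def)
  moreover have "(\<lambda>x. (f x + g x)\<^sup>2) \<in> borel_measurable \<mu>"
    by measurable
  moreover have "AE x in \<mu>. norm ((f x + g x)\<^sup>2) \<le> norm (2 * (f x)\<^sup>2 + 2 * (g x)\<^sup>2)"
  proof (rule AE_I2)
    fix x
    have "(f x + g x)\<^sup>2 \<le> 2 * (f x)\<^sup>2 + 2 * (g x)\<^sup>2"
      using sum_squares_bound[of "f x" "g x"] unfolding power2_sum by linarith
    then show "norm ((f x + g x)\<^sup>2) \<le> norm (2 * (f x)\<^sup>2 + 2 * (g x)\<^sup>2)"
      by simp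
  qed
  ultimately have "integrable \<mu> (\<lambda>x. (f x + g x)\<^sup>2)"
    by (rule Bochner_Integration.integrable_bound)
  then show ?thesis
    unfolding square_integrable_def by simp
qed

lemma square_integrable_diff:
  assumes "f \<in> square_integrable \<mu>" "g \<in> square_integrable \<mu>"
  shows "(\<lambda>x. f x - g x) \<in> square_integrable \<mu>"
  using square_integrable_add[OF assms(1) square_integrable_scale[OF assms(2), of "-1"]] by simp

lemma L2_le_class:
  assumes "f \<in> square_integrable \<mu>" "g \<in> square_integrable \<mu>"
  shows "L2_le \<mu> (L2_class \<mu> f) (L2_class \<mu> g) \<longleftrightarrow> (AE x in \<mu>. f x \<le> g x)"
proof -
  have "AE x in \<mu>. rep (L2_class \<mu> f) x \<le> rep (L2_class \<mu> g) x \<longleftrightarrow> f x \<le> g x"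
    using rep_L2_class(2)[OF assms(1)] rep_L2_class(2)[OF assms(2)] by eventually_elim simp
  then show ?thesis
    unfolding L2_le_def by (rule eventually_subst)
qed

lemma L2_scale_class:
  assumes "f \<in> square_integrable \<mu>"
  shows "L2_scale \<mu> c (L2_class \<mu> f) = L2_class \<mu> (\<lambda>x. c * f x)"
  unfolding L2_scale_def
proof (rule L2_class_cong)
  show "AE x in \<mu>. c * rep (L2_class \<mu> f) x = c * f x"
    using rep_L2_class(2)[OF assms] by eventually_elim simp
qed (rule square_integrable_scale rep_L2_class assms)+

lemma L2_add_class:
  assumes "f \<in> square_integrable \<mu>" "g \<in> square_integrable \<mu>"
  shows "L2_add \<mu> (L2_class \<mu> f) (L2_class \<mu> g) = L2_class \<mu> (\<lambda>x. f x + g x)"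
  unfolding L2_add_def
proof (rule L2_class_cong)
  show "AE x in \<mu>. rep (L2_class \<mu> f) x + rep (L2_class \<mu> g) x = f x + g x"
    using rep_L2_class(2)[OF assms(1)] rep_L2_class(2)[OF assms(2)] by eventually_elim simp
qed (rule square_integrable_add rep_L2_class assms)+

lemma L2_diff_class:
  assumes "f \<in> square_integrable \<mu>" "g \<in> square_integrable \<mu>"
  shows "L2_diff \<mu> (L2_class \<mu> f) (L2_class \<mu> g) = L2_class \<mu> (\<lambda>x. f x - g x)"
  unfolding L2_diff_def
proof (rule L2_class_cong)
  show "AE x in \<mu>. rep (L2_class \<mu> f) x - rep (L2_class \<mu> g) x = f x - g x"
    using rep_L2_class(2)[OF assms(1)] rep_L2_class(2)[OF assms(2)] by eventually_elim simp
qed (rule square_integrable_diff rep_L2_class assms)+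

section \<open>The fixed-point problem\<close>

definition solutions ::
  "'a measure \<Rightarrow> ('p \<Rightarrow> 'u \<Rightarrow> ('a \<Rightarrow> real) set) \<Rightarrow> (('a \<Rightarrow> real) set \<Rightarrow> 'p) \<Rightarrow> 'u \<Rightarrow> ('a \<Rightarrow> real) set set" where
  "solutions \<mu> S \<Phi> u = {y \<in> L2 \<mu>. y = S (\<Phi> y) u}"

definition max_solution ::
  "'a measure \<Rightarrow> ('p \<Rightarrow> 'u \<Rightarrow> ('a \<Rightarrow> real) set) \<Rightarrow> (('a \<Rightarrow> real) set \<Rightarrow> 'p) \<Rightarrow> 'u \<Rightarrow> ('a \<Rightarrow> real) set" where
  "max_solution \<mu> S \<Phi> u =
    (THE y. y \<in> solutions \<mu> S \<Phi> u \<and> (\<forall>z\<in>solutions \<mu> S \<Phi> u. L2_le \<mu> z y))"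

definition diff_quotient ::
  "'a measure \<Rightarrow> ('u::real_vector \<Rightarrow> ('a \<Rightarrow> real) set) \<Rightarrow> 'u \<Rightarrow> 'u \<Rightarrow> real \<Rightarrow> ('a \<Rightarrow> real) set" where
  "diff_quotient \<mu> F u h t = L2_scale \<mu> (1 / t) (L2_diff \<mu> (F (u + t *\<^sub>R h)) (F u))"

definition radial_directions :: "'u::real_vector set \<Rightarrow> 'u \<Rightarrow> 'u set" where
  "radial_directions U u = {l *\<^sub>R (w - u) | l w. l > 0 \<and> w \<in> U}"

end

theory Submission
  imports Defs
begin

text \<open>
  The maximal solution \<open>M w\<close> is the greatest subsolution, that is, the greatest \<open>v\<close> with
  \<open>v \<le> S (\<Phi> v) w\<close>. This is the Knaster--Tarski argument (\<open>monotone_map_greatest_subsolution\<close>): all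
  subsolutions lie below \<open>S pbar w\<close>, and countable suprema of nonnegative ones are again
  subsolutions. A greatest one is found by maximising \<open>\<integral>v\<^sup>2\<close> (\<open>L2_greatest_element\<close>).

  Concavity of \<open>S\<close> and \<open>\<Phi>\<close>, together with monotonicity of \<open>S\<close> in its first argument, shows that
  a convex combination of \<open>M w1\<close> and \<open>M w2\<close> is a subsolution for the corresponding combination
  of \<open>w1\<close> and \<open>w2\<close>. Hence \<open>M\<close> is concave, and its difference quotients along a ray increase as the
  step size decreases to \<open>0\<close> (\<open>diff_quotient_antimono\<close>).

  A family of functions that increases almost everywhere as its parameter decreases to \<open>0\<close> converges
  almost everywhere along any null sequence, namely to the supremum of the countably many functions
  involved. Any two null sequences interlace, so these suprema agree (\<open>antimono_family_unique_limit\<close>).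
\<close>

section \<open>Classes and their representatives\<close>

lemma L2_class_in_L2: "f \<in> square_integrable \<mu> \<Longrightarrow> L2_class \<mu> f \<in> L2 \<mu>"
  unfolding L2_class_def L2_def by (rule quotientI)

lemma L2_rep:
  assumes "v \<in> L2 \<mu>"
  shows "rep v \<in> square_integrable \<mu>" "L2_class \<mu> (rep v) = v"
proof -
  obtain f where f: "f \<in> square_integrable \<mu>" "v = L2_class \<mu> f"
    using assms unfolding L2_def L2_class_def by (auto elim: quotientE)
  show r: "rep v \<in> square_integrable \<mu>"
    using f rep_L2_class(1) by blast
  show "L2_class \<mu> (rep v) = v"
    using L2_class_cong[OF rep_L2_class(2)[OF f(1)] _ f(1)] f(2) r by simp
qed

lemma rep_L2_measurable: "v \<in> L2 \<mu> \<Longrightarrow> rep v \<in> borel_measurable \<mu>"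
  using L2_rep(1) unfolding square_integrable_def by blast

lemma L2_square_integrable: "v \<in> L2 \<mu> \<Longrightarrow> integrable \<mu> (\<lambda>x. (rep v x)\<^sup>2)"
  using L2_rep(1) unfolding square_integrable_def by blast

lemma L2_le_refl: "L2_le \<mu> v v"
  unfolding L2_le_def by simp

lemma L2_le_trans: "L2_le \<mu> a b \<Longrightarrow> L2_le \<mu> b c \<Longrightarrow> L2_le \<mu> a c"
  unfolding L2_le_def by (elim AE_mp) (auto elim: AE_mp)

lemma L2_le_antisym:
  assumes "a \<in> L2 \<mu>" "b \<in> L2 \<mu>" "L2_le \<mu> a b" "L2_le \<mu> b a"
  shows "a = b"
proof -
  have "AE x in \<mu>. rep a x = rep b x"
    using assms(3,4) unfolding L2_le_def by eventually_elim simp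
  then have "L2_class \<mu> (rep a) = L2_class \<mu> (rep b)"
    by (rule L2_class_cong) (use L2_rep assms in auto)
  then show ?thesis
    using L2_rep assms by metis
qed

lemma L2_nonneg_iff: "v \<in> L2_nonneg \<mu> \<longleftrightarrow> v \<in> L2 \<mu> \<and> (AE x in \<mu>. 0 \<le> rep v x)"
proof -
  have z: "(\<lambda>x. 0) \<in> square_integrable \<mu>"
    by (simp add: square_integrable_def)
  have "L2_le \<mu> (L2_zero \<mu>) v \<longleftrightarrow> (AE x in \<mu>. 0 \<le> rep v x)" if "v \<in> L2 \<mu>"
    using L2_le_class[OF z L2_rep(1)[OF that]] L2_rep(2)[OF that] by (simp add: L2_zero_def)
  then show ?thesis
    unfolding L2_nonneg_def by blast
qed

lemma rep_L2_lincomb: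
  assumes "v \<in> L2 \<mu>" "w \<in> L2 \<mu>"
  shows "L2_add \<mu> (L2_scale \<mu> a v) (L2_scale \<mu> b w) \<in> L2 \<mu>"
    and "AE x in \<mu>. rep (L2_add \<mu> (L2_scale \<mu> a v) (L2_scale \<mu> b w)) x = a * rep v x + b * rep w x"
proof -
  have sq: "(\<lambda>x. a * rep v x) \<in> square_integrable \<mu>" "(\<lambda>x. b * rep w x) \<in> square_integrable \<mu>"
    using assms L2_rep(1) square_integrable_scale by blast+
  have eq: "L2_add \<mu> (L2_scale \<mu> a v) (L2_scale \<mu> b w) = L2_class \<mu> (\<lambda>x. a * rep v x + b * rep w x)"
    using L2_add_class[OF sq] unfolding L2_scale_def .
  show "L2_add \<mu> (L2_scale \<mu> a v) (L2_scale \<mu> b w) \<in> L2 \<mu>"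
    unfolding eq by (intro L2_class_in_L2 square_integrable_add sq)
  show "AE x in \<mu>. rep (L2_add \<mu> (L2_scale \<mu> a v) (L2_scale \<mu> b w)) x = a * rep v x + b * rep w x"
    unfolding eq by (intro rep_L2_class(2) square_integrable_add sq)
qed

lemma rep_diff_quotient:
  assumes "F (u + t *\<^sub>R h) \<in> L2 \<mu>" "F u \<in> L2 \<mu>"
  shows "diff_quotient \<mu> F u h t \<in> L2 \<mu>"
    and "AE x in \<mu>. rep (diff_quotient \<mu> F u h t) x = (rep (F (u + t *\<^sub>R h)) x - rep (F u) x) / t"
proof -
  have sq: "(\<lambda>x. rep (F (u + t *\<^sub>R h)) x - rep (F u) x) \<in> square_integrable \<mu>"
    using assms L2_rep(1) square_integrable_diff by blast
  have eq: "diff_quotient \<mu> F u h t =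
      L2_class \<mu> (\<lambda>x. 1 / t * (rep (F (u + t *\<^sub>R h)) x - rep (F u) x))"
    unfolding diff_quotient_def using L2_scale_class[OF sq] by (simp add: L2_diff_def)
  show "diff_quotient \<mu> F u h t \<in> L2 \<mu>"
    unfolding eq by (intro L2_class_in_L2 square_integrable_scale sq)
  show "AE x in \<mu>. rep (diff_quotient \<mu> F u h t) x = (rep (F (u + t *\<^sub>R h)) x - rep (F u) x) / t"
    using rep_L2_class(2)[OF square_integrable_scale[OF sq, of "1 / t"]] unfolding eq by simp
qed


section \<open>Suprema and greatest elements in \<open>L\<^sup>2\<close>\<close>

lemma L2_countable_supremum:
  fixes v :: "nat \<Rightarrow> ('a \<Rightarrow> real) set"
  assumes v: "\<And>n. v n \<in> L2_nonneg \<mu>" and b: "b \<in> L2 \<mu>" and vb: "\<And>n. L2_le \<mu> (v n) b"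
  shows "\<exists>w\<in>L2_nonneg \<mu>. (\<forall>n. L2_le \<mu> (v n) w) \<and>
           (\<forall>z. (\<forall>n. L2_le \<mu> (v n) z) \<longrightarrow> L2_le \<mu> w z)"
proof -
  \<comment> \<open>The representatives are below \<open>rep b\<close> only almost everywhere; cutting them off at \<open>rep b\<close>
    makes the real supremum meaningful at every point.\<close>
  define f where "f = (\<lambda>x. SUP n. min (rep (v n) x) (rep b x))"
  have bdd: "bdd_above (range (\<lambda>n. min (rep (v n) x) (rep b x)))" for x
    by (rule bdd_aboveI[of _ "rep b x"]) auto
  have vL: "v n \<in> L2 \<mu>" for n
    using v L2_nonneg_iff by blast
  have [measurable]: "rep (v n) \<in> borel_measurable \<mu>" "rep b \<in> borel_measurable \<mu>" for n
    using vL b rep_L2_measurable by blast+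
  have f_meas [measurable]: "f \<in> borel_measurable \<mu>"
    unfolding f_def by (rule borel_measurable_cSUP) (auto intro: bdd)
  have le: "AE x in \<mu>. \<forall>n. rep (v n) x \<le> rep b x"
    using vb unfolding L2_le_def by (simp add: AE_all_countable)
  have nonneg: "AE x in \<mu>. \<forall>n. 0 \<le> rep (v n) x"
    using v unfolding L2_nonneg_iff by (simp add: AE_all_countable)
  have upper: "rep (v n) x \<le> f x" if "\<forall>n. rep (v n) x \<le> rep b x" for n x
    using cSUP_upper[OF UNIV_I bdd, of n x] that unfolding f_def by (simp add: min_absorb1)
  have fb: "f x \<le> rep b x" for x
    unfolding f_def by (rule cSUP_least) auto
  have fnn: "AE x in \<mu>. 0 \<le> f x"
    using le nonneg by eventually_elim (meson order_trans upper)
  have "AE x in \<mu>. norm ((f x)\<^sup>2) \<le> norm ((rep b x)\<^sup>2)"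
    using fnn by eventually_elim (simp add: fb power_mono)
  then have "integrable \<mu> (\<lambda>x. (f x)\<^sup>2)"
    by (intro Bochner_Integration.integrable_bound[OF L2_square_integrable[OF b]]) simp_all
  then have sq: "f \<in> square_integrable \<mu>"
    unfolding square_integrable_def by simp
  have r: "AE x in \<mu>. rep (L2_class \<mu> f) x = f x"
    by (rule rep_L2_class(2)[OF sq])
  show ?thesis
  proof (intro bexI[of _ "L2_class \<mu> f"] conjI allI impI)
    have "AE x in \<mu>. 0 \<le> rep (L2_class \<mu> f) x"
      using r fnn by eventually_elim simp
    then show "L2_class \<mu> f \<in> L2_nonneg \<mu>"
      by (simp add: L2_nonneg_iff L2_class_in_L2[OF sq])
    show "L2_le \<mu> (v n) (L2_class \<mu> f)" for n
      using r le unfolding L2_le_def by eventually_elim (simp add: upper)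
    fix z assume "\<forall>n. L2_le \<mu> (v n) z"
    then have "AE x in \<mu>. \<forall>n. rep (v n) x \<le> rep z x"
      unfolding L2_le_def by (simp add: AE_all_countable)
    then show "L2_le \<mu> (L2_class \<mu> f) z"
      unfolding L2_le_def using r
    proof eventually_elim
      case (elim x)
      have "f x \<le> rep z x"
        unfolding f_def by (rule cSUP_least) (use elim in \<open>auto intro: min.coboundedI1\<close>)
      with elim show ?case
        by simp
    qed
  qed
qed

text \<open>The functional \<open>v \<mapsto> \<integral>v\<^sup>2\<close> is strictly increasing on nonnegative classes, so an element at which
  it attains its maximum over a directed set is the greatest element. The maximum is attained
  because a maximising sequence has an upper bound in the set. This replaces the essential supremum
  of an uncountable family and works on measure spaces that are not \<open>\<sigma>\<close>-finite.\<close>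

lemma L2_greatest_element:
  assumes A: "A \<subseteq> L2_nonneg \<mu>" "A \<noteq> {}"
    and b: "b \<in> L2 \<mu>" "\<And>v. v \<in> A \<Longrightarrow> L2_le \<mu> v b"
    and dir: "\<And>v :: nat \<Rightarrow> ('a \<Rightarrow> real) set. (\<And>n. v n \<in> A) \<Longrightarrow> \<exists>w\<in>A. \<forall>n. L2_le \<mu> (v n) w"
  shows "\<exists>w\<in>A. \<forall>v\<in>A. L2_le \<mu> v w"
proof -
  define J where "J = (\<lambda>v :: ('a \<Rightarrow> real) set. \<integral>x. (rep v x)\<^sup>2 \<partial>\<mu>)"
  have AL: "v \<in> L2 \<mu>" "AE x in \<mu>. 0 \<le> rep v x" if "v \<in> A" for v
    using A that L2_nonneg_iff by blast+
  have J_mono: "J v \<le> J w" if "v \<in> A" "w \<in> L2 \<mu>" "L2_le \<mu> v w" for v w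
    unfolding J_def
  proof (rule integral_mono_AE)
    show "AE x in \<mu>. (rep v x)\<^sup>2 \<le> (rep w x)\<^sup>2"
      using AL(2)[OF that(1)] that(3) unfolding L2_le_def by eventually_elim (simp add: power_mono)
  qed (use that AL L2_square_integrable in blast)+
  have bdd: "bdd_above (J ` A)"
    by (rule bdd_aboveI2[of _ _ "J b"]) (use J_mono b in blast)
  define c where "c = Sup (J ` A)"
  have J_c: "J v \<le> c" if "v \<in> A" for v
    unfolding c_def using that bdd by (rule cSUP_upper)
  have "\<exists>v\<in>A. c - 1 / real (Suc n) < J v" for n
  proof -
    have "c - 1 / real (Suc n) < Sup (J ` A)"
      unfolding c_def by simp
    then show ?thesis
      using less_cSUP_iff[OF A(2) bdd] by simp
  qed
  then obtain v where v: "v n \<in> A" "c - 1 / real (Suc n) < J (v n)" for n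
    by metis
  obtain w where w: "w \<in> A" "\<And>n. L2_le \<mu> (v n) w"
    using dir[of v] v(1) by blast
  have "c - 1 / real (Suc n) \<le> J w" for n
    using J_mono[OF v(1) AL(1)[OF w(1)] w(2), of n] v(2)[of n] by linarith
  moreover have "(\<lambda>n. c - 1 / real (Suc n)) \<longlonglongrightarrow> c - 0"
    by (intro tendsto_diff tendsto_const LIMSEQ_Suc lim_1_over_n)
  ultimately have c_w: "c \<le> J w"
    by (intro LIMSEQ_le_const2[of _ c]) auto
  show ?thesis
  proof (rule bexI[OF _ w(1)], rule ballI)
    fix v' assume v': "v' \<in> A"
    \<comment> \<open>A common upper bound \<open>z\<close> of \<open>v'\<close> and \<open>w\<close> cannot exceed \<open>w\<close>, because \<open>w\<close> is a maximiser.\<close>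
    define s where "s = (\<lambda>n::nat. if n = 0 then v' else w)"
    have "s n \<in> A" for n
      using v' w(1) by (simp add: s_def)
    then obtain z where z: "z \<in> A" "\<And>n. L2_le \<mu> (s n) z"
      using dir[of s] by blast
    have zv: "L2_le \<mu> v' z" and zw: "L2_le \<mu> w z"
      using z(2)[of 0] z(2)[of 1] by (simp_all add: s_def)
    have int: "integrable \<mu> (\<lambda>x. (rep z x)\<^sup>2)" "integrable \<mu> (\<lambda>x. (rep w x)\<^sup>2)"
      using z(1) w(1) AL L2_square_integrable by blast+
    have nn: "AE x in \<mu>. 0 \<le> (rep z x)\<^sup>2 - (rep w x)\<^sup>2"
      using AL(2)[OF w(1)] zw unfolding L2_le_def by eventually_elim (simp add: power_mono)
    have "(\<integral>x. (rep z x)\<^sup>2 - (rep w x)\<^sup>2 \<partial>\<mu>) = J z - J w"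
      unfolding J_def by (rule Bochner_Integration.integral_diff[OF int])
    also have "\<dots> \<le> 0"
      using J_c[OF z(1)] c_w by simp
    finally have "(\<integral>x. (rep z x)\<^sup>2 - (rep w x)\<^sup>2 \<partial>\<mu>) = 0"
      using integral_nonneg_AE[OF nn] by simp
    then have "AE x in \<mu>. (rep z x)\<^sup>2 - (rep w x)\<^sup>2 = 0"
      using integral_nonneg_eq_0_iff_AE[OF Bochner_Integration.integrable_diff[OF int] nn] by simp
    then have "L2_le \<mu> z w"
      using AL(2)[OF w(1)] AL(2)[OF z(1)] unfolding L2_le_def
      by eventually_elim (simp add: power2_eq_iff_nonneg)
    with zv show "L2_le \<mu> v' w"
      by (rule L2_le_trans)
  qed
qed


section \<open>The maximal solution\<close>

text \<open>Knaster--Tarski for \<open>L\<^sup>2\<close>: the greatest nonnegative subsolution is a fixed point, since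
  \<open>T\<close> maps subsolutions to subsolutions. An arbitrary subsolution \<open>v\<close> lies below the nonnegative
  subsolution \<open>T v\<close>, so it lies below the fixed point as well.\<close>

lemma monotone_map_greatest_subsolution:
  assumes T: "\<And>v. v \<in> L2 \<mu> \<Longrightarrow> T v \<in> L2_nonneg \<mu>"
    and mono: "\<And>v w. v \<in> L2 \<mu> \<Longrightarrow> w \<in> L2 \<mu> \<Longrightarrow> L2_le \<mu> v w \<Longrightarrow> L2_le \<mu> (T v) (T w)"
    and b: "b \<in> L2 \<mu>" "\<And>v. v \<in> L2 \<mu> \<Longrightarrow> L2_le \<mu> (T v) b"
  shows "\<exists>y\<in>L2_nonneg \<mu>. y = T y \<and> (\<forall>v\<in>L2 \<mu>. L2_le \<mu> v (T v) \<longrightarrow> L2_le \<mu> v y)"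
proof -
  define A where "A = {v \<in> L2_nonneg \<mu>. L2_le \<mu> v (T v)}"
  have AL: "v \<in> L2 \<mu>" if "v \<in> A" for v
    using that by (simp add: A_def L2_nonneg_iff)
  have TL: "T v \<in> L2 \<mu>" if "v \<in> L2 \<mu>" for v
    using T[OF that] by (simp add: L2_nonneg_iff)
  have T_A: "T v \<in> A" if "v \<in> L2 \<mu>" "L2_le \<mu> v (T v)" for v
    using that T TL mono by (simp add: A_def)
  have Ab: "L2_le \<mu> v b" if "v \<in> A" for v
    using that b(2)[OF AL[OF that]] L2_le_trans by (auto simp: A_def)
  have "L2_zero \<mu> \<in> L2 \<mu>"
    unfolding L2_zero_def by (rule L2_class_in_L2) (simp add: square_integrable_def)
  moreover from this have "L2_le \<mu> (L2_zero \<mu>) (T (L2_zero \<mu>))"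
    using T unfolding L2_nonneg_def by blast
  ultimately have ne: "A \<noteq> {}"
    using T_A by blast
  have dir: "\<exists>w\<in>A. \<forall>n. L2_le \<mu> (v n) w" if v: "\<And>n. v n \<in> A" for v :: "nat \<Rightarrow> _"
  proof -
    obtain w where w: "w \<in> L2_nonneg \<mu>" "\<And>n. L2_le \<mu> (v n) w"
      "\<And>z. (\<And>n. L2_le \<mu> (v n) z) \<Longrightarrow> L2_le \<mu> w z"
      using L2_countable_supremum[of v \<mu> b] v Ab b(1) unfolding A_def by blast
    then have wL: "w \<in> L2 \<mu>"
      by (simp add: L2_nonneg_iff)
    have "L2_le \<mu> (v n) (T w)" for n
      using v[of n] mono[OF AL[OF v] wL w(2)] L2_le_trans unfolding A_def by blast
    then have "L2_le \<mu> w (T w)"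
      by (rule w(3))
    with w show ?thesis
      by (auto simp: A_def)
  qed
  obtain y where y: "y \<in> A" "\<And>v. v \<in> A \<Longrightarrow> L2_le \<mu> v y"
    using L2_greatest_element[of A \<mu> b, OF _ ne b(1) Ab dir] unfolding A_def by blast
  have yT: "L2_le \<mu> y (T y)"
    using y(1) by (simp add: A_def)
  have "y = T y"
    by (rule L2_le_antisym[OF AL[OF y(1)] TL[OF AL[OF y(1)]] yT y(2)[OF T_A[OF AL[OF y(1)] yT]]])
  moreover have "L2_le \<mu> v y" if "v \<in> L2 \<mu>" "L2_le \<mu> v (T v)" for v
    using that y(2)[OF T_A[OF that]] L2_le_trans by blast
  ultimately show ?thesis
    using y(1) by (auto simp: A_def)
qed

text \<open>The domination of all subsolutions, and not only of all solutions, is what gives lower bounds on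
  the maximal solution: a convex combination of solutions for different parameters is in general
  not a solution for the combined parameter, but under the concavity assumptions it is a subsolution.\<close>

lemma max_solution_greatest_subsolution:
  assumes T: "\<And>v. v \<in> L2 \<mu> \<Longrightarrow> S (\<Phi> v) u \<in> L2_nonneg \<mu>"
    and mono: "\<And>v w. v \<in> L2 \<mu> \<Longrightarrow> w \<in> L2 \<mu> \<Longrightarrow> L2_le \<mu> v w \<Longrightarrow> L2_le \<mu> (S (\<Phi> v) u) (S (\<Phi> w) u)"
    and b: "b \<in> L2 \<mu>" "\<And>v. v \<in> L2 \<mu> \<Longrightarrow> L2_le \<mu> (S (\<Phi> v) u) b"
  shows "max_solution \<mu> S \<Phi> u \<in> L2_nonneg \<mu>"
    and "max_solution \<mu> S \<Phi> u = S (\<Phi> (max_solution \<mu> S \<Phi> u)) u"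
    and "\<And>v. v \<in> L2 \<mu> \<Longrightarrow> L2_le \<mu> v (S (\<Phi> v) u) \<Longrightarrow> L2_le \<mu> v (max_solution \<mu> S \<Phi> u)"
proof -
  obtain y where y: "y \<in> L2_nonneg \<mu>" "y = S (\<Phi> y) u"
    "\<And>v. v \<in> L2 \<mu> \<Longrightarrow> L2_le \<mu> v (S (\<Phi> v) u) \<Longrightarrow> L2_le \<mu> v y"
    using monotone_map_greatest_subsolution[of \<mu> "\<lambda>v. S (\<Phi> v) u" b, OF T mono b] by blast
  have sol: "y \<in> solutions \<mu> S \<Phi> u"
    using y(1,2) by (simp add: solutions_def L2_nonneg_iff)
  have max: "L2_le \<mu> z y" if "z \<in> solutions \<mu> S \<Phi> u" for z
    using that y(3)[of z] L2_le_refl[of \<mu> z] by (auto simp: solutions_def)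
  have "max_solution \<mu> S \<Phi> u = y"
    unfolding max_solution_def
  proof (rule the_equality)
    fix z assume z: "z \<in> solutions \<mu> S \<Phi> u \<and> (\<forall>z'\<in>solutions \<mu> S \<Phi> u. L2_le \<mu> z' z)"
    with sol max show "z = y"
      by (intro L2_le_antisym[of z \<mu> y]) (auto simp: solutions_def)
  qed (use sol max in blast)
  with y show "max_solution \<mu> S \<Phi> u \<in> L2_nonneg \<mu>"
    "max_solution \<mu> S \<Phi> u = S (\<Phi> (max_solution \<mu> S \<Phi> u)) u"
    "\<And>v. v \<in> L2 \<mu> \<Longrightarrow> L2_le \<mu> v (S (\<Phi> v) u) \<Longrightarrow> L2_le \<mu> v (max_solution \<mu> S \<Phi> u)"
    by simp_all
qed


section \<open>Monotone difference quotients\<close>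

text \<open>The premise \<open>conc\<close> is concavity of \<open>F\<close> on the segment from \<open>u\<close> to \<open>u + t h\<close>, on which
  \<open>u + s h\<close> has the weights \<open>1 - s / t\<close> and \<open>s / t\<close>; it says that slopes from \<open>u\<close> decrease.\<close>

lemma diff_quotient_antimono:
  assumes F: "F u \<in> L2 \<mu>" "F (u + s *\<^sub>R h) \<in> L2 \<mu>" "F (u + t *\<^sub>R h) \<in> L2 \<mu>"
    and conc: "L2_le \<mu> (L2_add \<mu> (L2_scale \<mu> (s / t) (F (u + t *\<^sub>R h)))
                  (L2_scale \<mu> (1 - s / t) (F u))) (F (u + s *\<^sub>R h))"
    and st: "0 < s" "0 < t"
  shows "L2_le \<mu> (diff_quotient \<mu> F u h t) (diff_quotient \<mu> F u h s)"
  using conc rep_L2_lincomb(2)[OF F(3) F(1), of "s / t" "1 - s / t"]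
    rep_diff_quotient(2)[where F = F, OF F(2) F(1)] rep_diff_quotient(2)[where F = F, OF F(3) F(1)]
  unfolding L2_le_def
proof eventually_elim
  case (elim x)
  define a b c where "a = rep (F (u + t *\<^sub>R h)) x" "b = rep (F u) x" "c = rep (F (u + s *\<^sub>R h)) x"
  have "s / t * a + (1 - s / t) * b \<le> c"
    using elim a_b_c_def by simp
  then have "s / t * (a - b) \<le> c - b"
    by (simp add: algebra_simps diff_divide_distrib)
  then have "(a - b) / t \<le> (c - b) / s"
    using st by (simp add: field_simps)
  then show ?case
    using elim a_b_c_def by simp
qed

text \<open>The exceptional null sets of the inequalities \<open>q t \<le> q s\<close> depend on the parameters, so the
  pointwise supremum over all \<open>t\<close> depends on the representatives. The supremum along one fixed null sequence
  suffices: comparing it with another null sequence involves only countably many inequalities, and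
  these interlace the two sequences almost everywhere. The limit may be \<open>\<infinity>\<close>, but not \<open>-\<infinity>\<close>, since it
  dominates a real-valued function.\<close>

lemma antimono_family_unique_limit:
  assumes \<tau>0: "\<tau>0 > 0"
    and q: "\<And>t. 0 < t \<Longrightarrow> t < \<tau>0 \<Longrightarrow> q t \<in> L2 \<mu>"
    and anti: "\<And>s t. 0 < s \<Longrightarrow> s \<le> t \<Longrightarrow> t < \<tau>0 \<Longrightarrow> L2_le \<mu> (q t) (q s)"
  shows "\<exists>!\<delta>. \<delta> \<in> L0_ext \<mu> \<and>
           (\<forall>\<tau>s :: nat \<Rightarrow> real. (\<forall>n. \<tau>s n \<in> {0<..<\<tau>0}) \<and> \<tau>s \<longlonglongrightarrow> 0 \<longrightarrow>
              ae_tendsto \<mu> (\<lambda>n. q (\<tau>s n)) \<delta>)"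
proof -
  define t where "t k = \<tau>0 / real (Suc (Suc k))" for k
  have t: "0 < t k" "t k < \<tau>0" for k
    using \<tau>0 by (simp_all add: t_def field_simps add_pos_nonneg)
  have "(\<lambda>k. \<tau>0 * (1 / real (Suc (Suc k)))) \<longlonglongrightarrow> \<tau>0 * 0"
    by (intro tendsto_mult tendsto_const LIMSEQ_Suc lim_1_over_n)
  then have t_lim: "t \<longlonglongrightarrow> 0"
    by (simp add: t_def[abs_def])
  have [measurable]: "rep (q (t k)) \<in> borel_measurable \<mu>" for k
    using t q rep_L2_measurable by blast
  define f where "f x = (SUP k. ereal (rep (q (t k)) x))" for x
  have f_above: "- \<infinity> < f x" for x
  proof -
    have "- \<infinity> < ereal (rep (q (t 0)) x)"
      by simp
    also have "\<dots> \<le> f x"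
      unfolding f_def by (rule SUP_upper) simp
    finally show ?thesis .
  qed
  have "f \<in> borel_measurable \<mu>"
    unfolding f_def by measurable
  then have f: "f \<in> meas_above_minf \<mu>"
    unfolding meas_above_minf_def using f_above by blast
  define d where "d = ae_eq_rel \<mu> (meas_above_minf \<mu>) `` {f}"
  have d: "d \<in> L0_ext \<mu>"
    unfolding d_def L0_ext_def by (rule quotientI[OF f])
  have rep_d: "AE x in \<mu>. rep d x = f x"
    unfolding d_def by (rule rep_class(2)[OF f])
  have conv: "ae_tendsto \<mu> (\<lambda>n. q (\<tau>s n)) d"
    if \<tau>s: "\<And>n. \<tau>s n \<in> {0<..<\<tau>0}" "\<tau>s \<longlonglongrightarrow> 0" for \<tau>s :: "nat \<Rightarrow> real"
  proof -
    have "AE x in \<mu>. \<forall>n k. \<tau>s n \<le> t k \<longrightarrow> rep (q (t k)) x \<le> rep (q (\<tau>s n)) x"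
    proof (intro AE_all_countable[THEN iffD2] allI)
      fix n k
      show "AE x in \<mu>. \<tau>s n \<le> t k \<longrightarrow> rep (q (t k)) x \<le> rep (q (\<tau>s n)) x"
      proof (cases "\<tau>s n \<le> t k")
        case True
        then show ?thesis
          using anti[OF _ True] \<tau>s(1)[of n] t[of k] by (simp add: L2_le_def)
      qed simp
    qed
    moreover have "AE x in \<mu>. \<forall>n k. t k \<le> \<tau>s n \<longrightarrow> rep (q (\<tau>s n)) x \<le> rep (q (t k)) x"
    proof (intro AE_all_countable[THEN iffD2] allI)
      fix n k
      show "AE x in \<mu>. t k \<le> \<tau>s n \<longrightarrow> rep (q (\<tau>s n)) x \<le> rep (q (t k)) x"
      proof (cases "t k \<le> \<tau>s n")
        case True
        then show ?thesis
          using anti[OF _ True] \<tau>s(1)[of n] t[of k] by (simp add: L2_le_def)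
      qed simp
    qed
    ultimately show ?thesis
      unfolding ae_tendsto_def using rep_d
    proof eventually_elim
      case (elim x)
      note interlaced = elim
      have "(\<lambda>n. ereal (rep (q (\<tau>s n)) x)) \<longlonglongrightarrow> f x"
      proof (rule order_tendstoI)
        fix a assume "a < f x"
        then obtain k where k: "a < ereal (rep (q (t k)) x)"
          unfolding f_def less_SUP_iff by blast
        have "eventually (\<lambda>n. \<tau>s n < t k) sequentially"
          using \<tau>s(2) t(1) by (rule order_tendstoD(2))
        then show "eventually (\<lambda>n. a < ereal (rep (q (\<tau>s n)) x)) sequentially"
        proof eventually_elim
          case (elim n)
          then have "ereal (rep (q (t k)) x) \<le> ereal (rep (q (\<tau>s n)) x)"
            using interlaced(1) by simp
          with k show ?case
            by (rule less_le_trans)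
        qed
      next
        fix a assume a: "f x < a"
        have "ereal (rep (q (\<tau>s n)) x) < a" for n
        proof -
          have "eventually (\<lambda>k. t k < \<tau>s n) sequentially"
            using t_lim by (rule order_tendstoD(2)) (use \<tau>s(1)[of n] in simp)
          then obtain k where "t k < \<tau>s n"
            by (auto dest: eventually_happens)
          then have "ereal (rep (q (\<tau>s n)) x) \<le> ereal (rep (q (t k)) x)"
            using elim by simp
          also have "\<dots> \<le> f x"
            unfolding f_def by (rule SUP_upper) simp
          finally show ?thesis
            using a by simp
        qed
        then show "eventually (\<lambda>n. ereal (rep (q (\<tau>s n)) x) < a) sequentially"
          by simp
      qed
      with elim show ?case
        by simp
    qed
  qed
  show ?thesis
  proof (rule ex1I[of _ d])
    show "d \<in> L0_ext \<mu> \<and> (\<forall>\<tau>s :: nat \<Rightarrow> real. (\<forall>n. \<tau>s n \<in> {0<..<\<tau>0}) \<and> \<tau>s \<longlonglongrightarrow> 0 \<longrightarrow>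
              ae_tendsto \<mu> (\<lambda>n. q (\<tau>s n)) d)"
      using d conv by blast
  next
    fix e
    assume e: "e \<in> L0_ext \<mu> \<and> (\<forall>\<tau>s :: nat \<Rightarrow> real. (\<forall>n. \<tau>s n \<in> {0<..<\<tau>0}) \<and> \<tau>s \<longlonglongrightarrow> 0 \<longrightarrow>
              ae_tendsto \<mu> (\<lambda>n. q (\<tau>s n)) e)"
    have t_in: "t n \<in> {0<..<\<tau>0}" for n
      using t by simp
    have "ae_tendsto \<mu> (\<lambda>n. q (t n)) e"
      using e t_in t_lim by blast
    moreover have "ae_tendsto \<mu> (\<lambda>n. q (t n)) d"
      by (rule conv[OF t_in t_lim])
    ultimately have re: "AE x in \<mu>. rep e x = f x"
      unfolding ae_tendsto_def using rep_d
    proof eventually_elim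
      case (elim x)
      then have "rep e x = rep d x"
        by (blast intro: LIMSEQ_unique)
      with elim(3) show ?case
        by simp
    qed
    obtain g where g: "g \<in> meas_above_minf \<mu>" "e = ae_eq_rel \<mu> (meas_above_minf \<mu>) `` {g}"
      using e unfolding L0_ext_def by (auto elim: quotientE)
    have "AE x in \<mu>. g x = f x"
      using re rep_class(2)[OF g(1), of \<mu>] unfolding g(2) by eventually_elim simp
    then show "e = d"
      unfolding g(2) d_def
      by (intro equiv_class_eq[OF equiv_ae_eq_rel]) (use f g(1) in \<open>simp add: ae_eq_rel_def\<close>)
  qed
qed


section \<open>Directional differentiability of the maximal solution\<close>

theorem theorem4p3:
  fixes \<mu> :: "'a measure"
    and Pbar P :: "'p::real_vector set"
    and pbar :: 'p
    and le_P :: "('p \<times> 'p) set"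
    and U :: "'u::real_vector set"
    and S :: "'p \<Rightarrow> 'u \<Rightarrow> ('a \<Rightarrow> real) set"
    and \<Phi> :: "('a \<Rightarrow> real) set \<Rightarrow> 'p"
    and u h :: 'u
    and \<tau>0 :: real
  assumes "complete_measure \<mu>"
    and "partial_order_on Pbar le_P"
    and "\<exists>p\<in>Pbar. \<exists>q\<in>Pbar. p \<noteq> q"
    and "pbar \<in> Pbar" and "\<forall>p\<in>Pbar. (p, pbar) \<in> le_P"
    and "P = Pbar - {pbar}"
    and "U \<noteq> {}"
    and "\<forall>p\<in>Pbar. \<forall>w\<in>U. S p w \<in> L2_nonneg \<mu>"
    and "\<forall>w\<in>U. \<forall>p1\<in>Pbar. \<forall>p2\<in>Pbar. (p1, p2) \<in> le_P \<longrightarrow> L2_le \<mu> (S p1 w) (S p2 w)"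
    and "\<forall>v\<in>L2 \<mu>. \<Phi> v \<in> P"
    and "\<forall>v1\<in>L2 \<mu>. \<forall>v2\<in>L2 \<mu>. L2_le \<mu> v1 v2 \<longrightarrow> (\<Phi> v1, \<Phi> v2) \<in> le_P"
    and "convex P" and "convex U"
    and "\<forall>p1\<in>P. \<forall>p2\<in>P. \<forall>u1\<in>U. \<forall>u2\<in>U. \<forall>l\<in>{0..1}.
           L2_le \<mu> (L2_add \<mu> (L2_scale \<mu> l (S p1 u1)) (L2_scale \<mu> (1 - l) (S p2 u2)))
                   (S (l *\<^sub>R p1 + (1 - l) *\<^sub>R p2) (l *\<^sub>R u1 + (1 - l) *\<^sub>R u2))"
    and "\<forall>v1\<in>L2_nonneg \<mu>. \<forall>v2\<in>L2_nonneg \<mu>. \<forall>l\<in>{0..1}.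
           (l *\<^sub>R \<Phi> v1 + (1 - l) *\<^sub>R \<Phi> v2,
            \<Phi> (L2_add \<mu> (L2_scale \<mu> l v1) (L2_scale \<mu> (1 - l) v2))) \<in> le_P"
    and "u \<in> U"
    and "h \<in> radial_directions U u"
    and "\<tau>0 > 0"
    and "\<forall>\<tau>\<in>{0<..<\<tau>0}. u + \<tau> *\<^sub>R h \<in> U"
  shows "\<exists>!\<delta>. \<delta> \<in> L0_ext \<mu> \<and>
           (\<forall>\<tau>s :: nat \<Rightarrow> real. (\<forall>n. \<tau>s n \<in> {0<..<\<tau>0}) \<and> \<tau>s \<longlonglongrightarrow> 0 \<longrightarrow>
              ae_tendsto \<mu> (\<lambda>n. diff_quotient \<mu> (max_solution \<mu> S \<Phi>) u h (\<tau>s n)) \<delta>)"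
proof -
  note Pbar_P = assms(6)
  note S_nonneg = assms(8)[rule_format] and S_mono = assms(9)[rule_format]
  note \<Phi>_P = assms(10)[rule_format] and \<Phi>_mono = assms(11)[rule_format]
  note S_conc = assms(14)[rule_format] and \<Phi>_conc = assms(15)[rule_format]
  define M where "M = max_solution \<mu> S \<Phi>"
  have \<Phi>_Pbar: "\<Phi> v \<in> Pbar" if "v \<in> L2 \<mu>" for v
    using \<Phi>_P[OF that] Pbar_P by blast
  have M_nonneg: "M w \<in> L2_nonneg \<mu>" and M_eq: "M w = S (\<Phi> (M w)) w"
    and M_sub: "\<And>v. v \<in> L2 \<mu> \<Longrightarrow> L2_le \<mu> v (S (\<Phi> v) w) \<Longrightarrow> L2_le \<mu> v (M w)" if w: "w \<in> U" for w
  proof -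
    have b: "S pbar w \<in> L2 \<mu>"
      using S_nonneg[OF assms(4) w] by (simp add: L2_nonneg_iff)
    have 1: "S (\<Phi> v) w \<in> L2_nonneg \<mu>" "L2_le \<mu> (S (\<Phi> v) w) (S pbar w)" if "v \<in> L2 \<mu>" for v
      using S_nonneg S_mono \<Phi>_Pbar[OF that] assms(4,5) w by blast+
    have 2: "L2_le \<mu> (S (\<Phi> v) w) (S (\<Phi> v') w)" if "v \<in> L2 \<mu>" "v' \<in> L2 \<mu>" "L2_le \<mu> v v'" for v v'
      using S_mono \<Phi>_mono \<Phi>_Pbar that w by blast
    note * = max_solution_greatest_subsolution[of \<mu> S \<Phi> w, OF 1(1) 2 b 1(2)]
    show "M w \<in> L2_nonneg \<mu>" "M w = S (\<Phi> (M w)) w"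
      "\<And>v. v \<in> L2 \<mu> \<Longrightarrow> L2_le \<mu> v (S (\<Phi> v) w) \<Longrightarrow> L2_le \<mu> v (M w)"
      unfolding M_def using * by blast+
  qed
  have M_L2: "M w \<in> L2 \<mu>" if "w \<in> U" for w
    using M_nonneg[OF that] by (simp add: L2_nonneg_iff)
  \<comment> \<open>Concavity of \<open>M\<close>: the convex combination \<open>?z\<close> of two maximal solutions is a subsolution.\<close>
  have M_conc: "L2_le \<mu> (L2_add \<mu> (L2_scale \<mu> l (M w1)) (L2_scale \<mu> (1 - l) (M w2)))
      (M (l *\<^sub>R w1 + (1 - l) *\<^sub>R w2))" if w: "w1 \<in> U" "w2 \<in> U" and l: "l \<in> {0..1}" for w1 w2 l
  proof -
    let ?z = "L2_add \<mu> (L2_scale \<mu> l (M w1)) (L2_scale \<mu> (1 - l) (M w2))"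
    let ?p = "l *\<^sub>R \<Phi> (M w1) + (1 - l) *\<^sub>R \<Phi> (M w2)"
    let ?w = "l *\<^sub>R w1 + (1 - l) *\<^sub>R w2"
    have z: "?z \<in> L2 \<mu>"
      by (rule rep_L2_lincomb(1)[OF M_L2 M_L2, OF w])
    have wU: "?w \<in> U"
      using convexD[OF assms(13) w, of l "1 - l"] l by simp
    have p: "?p \<in> P"
      using convexD[OF assms(12) \<Phi>_P[OF M_L2] \<Phi>_P[OF M_L2], OF w, of l "1 - l"] l by simp
    have "L2_le \<mu> ?z (S ?p ?w)"
      using S_conc[OF \<Phi>_P[OF M_L2] \<Phi>_P[OF M_L2], OF w w l] M_eq[OF w(1)] M_eq[OF w(2)] by simp
    moreover have "L2_le \<mu> (S ?p ?w) (S (\<Phi> ?z) ?w)"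
      using S_mono[OF wU _ \<Phi>_Pbar[OF z] \<Phi>_conc[OF M_nonneg M_nonneg, OF w l]] p Pbar_P by blast
    ultimately have "L2_le \<mu> ?z (S (\<Phi> ?z) ?w)"
      by (rule L2_le_trans)
    then show ?thesis
      by (rule M_sub[OF wU z])
  qed
  have ray: "u + t *\<^sub>R h \<in> U" if "0 < t" "t < \<tau>0" for t
    using assms(19) that by simp
  have q: "diff_quotient \<mu> M u h t \<in> L2 \<mu>" if "0 < t" "t < \<tau>0" for t
    by (rule rep_diff_quotient(1)[where F = M, OF M_L2 M_L2, OF ray assms(16), OF that])
  have anti: "L2_le \<mu> (diff_quotient \<mu> M u h t) (diff_quotient \<mu> M u h s)"
    if st: "0 < s" "s \<le> t" "t < \<tau>0" for s t
  proof (rule diff_quotient_antimono)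
    have U: "u + t *\<^sub>R h \<in> U" "u + s *\<^sub>R h \<in> U"
      using ray st by simp_all
    have "(s / t) *\<^sub>R (u + t *\<^sub>R h) + (1 - s / t) *\<^sub>R u = u + s *\<^sub>R h"
      using st by (simp add: algebra_simps)
    then show "L2_le \<mu> (L2_add \<mu> (L2_scale \<mu> (s / t) (M (u + t *\<^sub>R h)))
        (L2_scale \<mu> (1 - s / t) (M u))) (M (u + s *\<^sub>R h))"
      using M_conc[OF U(1) assms(16), of "s / t"] st by simp
    show "M u \<in> L2 \<mu>" "M (u + s *\<^sub>R h) \<in> L2 \<mu>" "M (u + t *\<^sub>R h) \<in> L2 \<mu>"
      using M_L2 U assms(16) by blast+
  qed (use st in simp_all)
  show ?thesis
    using antimono_family_unique_limit[of \<tau>0 "diff_quotient \<mu> M u h" \<mu>, OF assms(18) q anti]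
    unfolding M_def .
qed

end
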